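(* Let $k \ge 3$ be an integer and let $D$ be a $k$-partite tournament. Then the stability number (maximum size of a set of pairwise nonadjacent vertices) of the niche graph $\mathcal{N}(D)$ is at most $3$.
   Context: A $k$-partite tournament is an orientation of a complete $k$-partite graph with $k$ nonempty partite sets. The niche graph $\mathcal{N}(D)$ of a digraph $D$ has vertex set $V(D)$, and two distinct vertices $u,v$ are adjacent iff they have a common out-neighbor in $D$ or a common in-neighbor in $D$. *)

theory Defs
  imports
    "Graph_Theory.Pair_Digraph"
    "HOL-Library.Disjoint_Sets"
    "HOL-Library.Extended_Nat"
begin

text \<open>
  Undirected simple graphs are represented, as usual in \<^theory>\<open>Graph_Theory.Pair_Digraph\<close>,
  by symmetric loop-free digraphs (\<^locale>\<open>pair_bidirected_digraph\<close>): an edge between \<open>u\<close> and \<open>v\<close>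
  is the pair of arcs \<open>(u, v)\<close>, \<open>(v, u)\<close>. Vertex sets are not required to be finite.
\<close>

text \<open>The partite sets are nonempty because \<^const>\<open>partition_on\<close> demands this of every block.\<close>

definition complete_multipartite :: "nat \<Rightarrow> 'a pair_pre_digraph \<Rightarrow> bool" where
  "complete_multipartite k G \<longleftrightarrow> pair_bidirected_digraph G \<and>
    (\<exists>P. partition_on (pverts G) P \<and> finite P \<and> card P = k \<and>
      (\<forall>u \<in> pverts G. \<forall>v \<in> pverts G.
        (u, v) \<in> parcs G \<longleftrightarrow> \<not> (\<exists>X \<in> P. u \<in> X \<and> v \<in> X)))"

text \<open>An orientation replaces each edge of \<open>G\<close> by exactly one of its two arcs.\<close>

definition orientation_of :: "'a pair_pre_digraph \<Rightarrow> 'a pair_pre_digraph \<Rightarrow> bool" where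
  "orientation_of D G \<longleftrightarrow> pverts D = pverts G \<and>
    parcs D \<union> (parcs D)\<inverse> = parcs G \<and> parcs D \<inter> (parcs D)\<inverse> = {}"

definition multipartite_tournament :: "nat \<Rightarrow> 'a pair_pre_digraph \<Rightarrow> bool" where
  "multipartite_tournament k D \<longleftrightarrow> (\<exists>G. complete_multipartite k G \<and> orientation_of D G)"

definition niche_graph :: "'a pair_pre_digraph \<Rightarrow> 'a pair_pre_digraph" where
  "niche_graph D = \<lparr> pverts = pverts D,
    parcs = {(u, v). u \<in> pverts D \<and> v \<in> pverts D \<and> u \<noteq> v \<and>
      ((\<exists>w \<in> pverts D. (u, w) \<in> parcs D \<and> (v, w) \<in> parcs D) \<or>
       (\<exists>w \<in> pverts D. (w, u) \<in> parcs D \<and> (w, v) \<in> parcs D))} \<rparr>"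

definition stable_set :: "'a pair_pre_digraph \<Rightarrow> 'a set \<Rightarrow> bool" where
  "stable_set G S \<longleftrightarrow> S \<subseteq> pverts G \<and> (\<forall>u \<in> S. \<forall>v \<in> S. u \<noteq> v \<longrightarrow> (u, v) \<notin> parcs G)"

text \<open>
  The value lies in \<^typ>\<open>enat\<close> so that a graph with arbitrarily large or infinite stable sets
  gets the value \<open>\<infinity>\<close> (\<^const>\<open>card\<close> of an infinite set is \<open>0\<close>). For a finite graph this is the
  usual maximum, see \<open>stability_number_finite\<close> below.
\<close>

definition stability_number :: "'a pair_pre_digraph \<Rightarrow> enat" where
  "stability_number G =
    (SUP S \<in> {S. stable_set G S}. if finite S then enat (card S) else \<infinity>)"

lemma pair_bidirected_digraph_niche_graph: "pair_bidirected_digraph (niche_graph D)"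
proof unfold_locales
  show "symmetric (with_proj (niche_graph D))"
    by (auto simp: symmetric_def arcs_ends_conv niche_graph_def sym_def)
qed (auto simp: niche_graph_def)

lemma stability_number_finite:
  assumes "finite (pverts G)"
  shows "stability_number G = enat (Max (card ` {S. stable_set G S}))"
proof -
  let ?A = "{S. stable_set G S}"
  have sub: "?A \<subseteq> Pow (pverts G)" by (auto simp: stable_set_def)
  then have fin: "finite ?A" using assms by (meson finite_Pow_iff finite_subset)
  have "{} \<in> ?A" by (simp add: stable_set_def)
  then have ne: "?A \<noteq> {}" by blast
  have finS: "finite S" if "S \<in> ?A" for S
    using that sub assms by (meson PowD finite_subset subsetD)
  have "Max (card ` ?A) \<in> card ` ?A" using fin ne by (intro Max_in) auto
  then obtain M where M: "M \<in> ?A" "Max (card ` ?A) = card M" by blast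
  show ?thesis unfolding stability_number_def
  proof (rule antisym)
    show "(SUP S \<in> ?A. if finite S then enat (card S) else \<infinity>) \<le> enat (Max (card ` ?A))"
      using fin finS by (intro SUP_least) auto
    show "enat (Max (card ` ?A)) \<le> (SUP S \<in> ?A. if finite S then enat (card S) else \<infinity>)"
      by (rule SUP_upper2[OF M(1)]) (use finS[OF M(1)] M(2) in auto)
  qed
qed

end

theory Submission
  imports Defs
begin

text \<open>
  A vertex has at most one out-neighbour and at most one in-neighbour in a stable set \<open>S\<close> of the
  niche graph, and it is adjacent to everything outside its own partite set \<open>X\<close>; hence
  \<open>card (S - X) \<le> 2\<close>. Each element of \<open>S\<close> avoids at least two of any three partite sets, so
  summing over three of them gives \<open>2 * card S \<le> 6\<close>.
\<close>

lemma stable_set_subset: "stable_set G S \<Longrightarrow> T \<subseteq> S \<Longrightarrow> stable_set G T"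
  unfolding stable_set_def by blast

text \<open>An infinite stable set would contain a finite one with \<open>Suc n\<close> elements,
  stable by heredity. So bounding the finite stable sets by \<open>n\<close> also excludes the value
  \<open>\<infinity>\<close> from the supremum.\<close>

lemma stability_number_leI:
  assumes "\<And>S. stable_set G S \<Longrightarrow> finite S \<Longrightarrow> card S \<le> n"
  shows "stability_number G \<le> enat n"
proof -
  have "finite S" if "stable_set G S" for S
  proof (rule ccontr)
    assume "infinite S"
    then obtain T where "finite T" "card T = Suc n" "T \<subseteq> S"
      using infinite_arbitrarily_large by blast
    with assms[of T] stable_set_subset[OF that] show False by simp
  qed
  then show ?thesis
    unfolding stability_number_def by (intro SUP_least) (use assms in auto)
qed

text \<open>Two distinct out-neighbours of \<open>w\<close> have \<open>w\<close> as a common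
  in-neighbour, hence are adjacent in the niche graph; dually for in-neighbours.\<close>

lemma card_le_one_neighbour:
  assumes S: "stable_set (niche_graph D) S" and "finite S" and w: "w \<in> pverts D"
  shows "card {s \<in> S. (w, s) \<in> parcs D} \<le> 1" and "card {s \<in> S. (s, w) \<in> parcs D} \<le> 1"
proof -
  have "s = t" if "s \<in> S" "t \<in> S" "(w, s) \<in> parcs D \<and> (w, t) \<in> parcs D \<or>
      (s, w) \<in> parcs D \<and> (t, w) \<in> parcs D" for s t
    using S w that unfolding stable_set_def niche_graph_def by fastforce
  then show "card {s \<in> S. (w, s) \<in> parcs D} \<le> 1" "card {s \<in> S. (s, w) \<in> parcs D} \<le> 1"
    using \<open>finite S\<close> by (auto simp: card_le_Suc0_iff_eq)
qed

lemma card_stable_set_diff_partite_set: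
  assumes S: "stable_set (niche_graph D) S" and "finite S" "w \<in> pverts D"
    and adj: "\<And>v. v \<in> pverts D \<Longrightarrow> v \<notin> X \<Longrightarrow> (w, v) \<in> parcs D \<or> (v, w) \<in> parcs D"
  shows "card (S - X) \<le> 2"
proof -
  let ?O = "{s \<in> S. (w, s) \<in> parcs D}" and ?I = "{s \<in> S. (s, w) \<in> parcs D}"
  have "S \<subseteq> pverts D"
    using S by (simp add: stable_set_def niche_graph_def)
  then have "S - X \<subseteq> ?O \<union> ?I"
    using adj by blast
  then have "card (S - X) \<le> card (?O \<union> ?I)"
    using \<open>finite S\<close> by (intro card_mono) auto
  also have "\<dots> \<le> card ?O + card ?I"
    by (rule card_Un_le)
  also have "\<dots> \<le> 1 + 1"
    using card_le_one_neighbour[OF assms(1-3)] by (rule add_mono)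
  finally show ?thesis by simp
qed

text \<open>By disjointness the three intersections with \<open>S\<close> have total size at most
  \<open>card S\<close>. Splitting \<open>S\<close> along each of the three sets and adding up gives
  \<open>3 * card S \<le> card S + 6\<close>.\<close>

lemma card_le_three_of_diff_le_two:
  assumes "finite S" "X \<inter> Y = {}" "X \<inter> Z = {}" "Y \<inter> Z = {}"
    and "card (S - X) \<le> 2" "card (S - Y) \<le> 2" "card (S - Z) \<le> 2"
  shows "card S \<le> 3"
proof -
  have "card (S \<inter> X) + card (S \<inter> Y) + card (S \<inter> Z) = card (S \<inter> (X \<union> Y \<union> Z))"
    using assms(1-4) by (simp add: Int_Un_distrib card_Un_disjoint Int_Un_distrib2 Int_left_commute inf_assoc)
  also have "\<dots> \<le> card S"
    using assms(1) by (intro card_mono) auto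
  moreover have "card S = card (S \<inter> A) + card (S - A)" for A
    using assms(1) by (rule card_Int_Diff)
  note this[of X] this[of Y] this[of Z]
  ultimately show ?thesis
    using assms(5-7) by linarith
qed

theorem theorem2p7:
  fixes k :: nat and D :: "'a pair_pre_digraph"
  assumes "k \<ge> 3"
    and "multipartite_tournament k D"
  shows "stability_number (niche_graph D) \<le> 3"
proof -
  obtain G P where D: "orientation_of D G" and P: "partition_on (pverts G) P" and "card P = k"
    and arcs: "\<And>u v. u \<in> pverts G \<Longrightarrow> v \<in> pverts G \<Longrightarrow>
      (u, v) \<in> parcs G \<longleftrightarrow> \<not> (\<exists>X \<in> P. u \<in> X \<and> v \<in> X)"
    using assms(2) unfolding multipartite_tournament_def complete_multipartite_def by blast
  have verts: "pverts D = pverts G"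
    using D by (simp add: orientation_of_def)
  have diff: "card (S - X) \<le> 2"
    if S: "stable_set (niche_graph D) S" "finite S" and X: "X \<in> P" for S X
  proof -
    \<comment> \<open>Blocks are nonempty, so \<open>X\<close> supplies a vertex \<open>w\<close>,
      which may lie outside \<open>S\<close>.\<close>
    obtain w where w: "w \<in> X"
      using partition_onD3[OF P] X by fastforce
    then have wG: "w \<in> pverts G"
      using partition_onD1[OF P] X by blast
    have "(w, v) \<in> parcs D \<or> (v, w) \<in> parcs D" if v: "v \<in> pverts D" "v \<notin> X" for v
    proof -
      \<comment> \<open>Blocks are disjoint, so \<open>X\<close> is the only one containing
        \<open>w\<close>, and it misses \<open>v\<close>.\<close>
      have "\<not> (\<exists>Y \<in> P. w \<in> Y \<and> v \<in> Y)"
        using partition_onD2[OF P] X w v(2) by (auto dest: disjointD)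
      then have "(w, v) \<in> parcs G"
        using arcs wG v(1) verts by simp
      then show ?thesis
        using D unfolding orientation_of_def by blast
    qed
    then show ?thesis
      using card_stable_set_diff_partite_set[OF S] wG verts by simp
  qed
  \<comment> \<open>Here \<open>k \<ge> 3\<close> enters: it provides the three distinct blocks for
    the count.\<close>
  obtain T where "T \<subseteq> P" "card T = 3"
    using obtain_subset_with_card_n assms(1) \<open>card P = k\<close> by metis
  then obtain X Y Z where XYZ: "X \<in> P" "Y \<in> P" "Z \<in> P" "X \<noteq> Y" "X \<noteq> Z" "Y \<noteq> Z"
    unfolding card_3_iff by auto
  then have disj: "X \<inter> Y = {}" "X \<inter> Z = {}" "Y \<inter> Z = {}"
    using partition_onD2[OF P] by (auto dest: disjointD)
  have "card S \<le> 3" if "stable_set (niche_graph D) S" "finite S" for S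
    using card_le_three_of_diff_le_two[OF that(2) disj] diff[OF that] XYZ(1-3) by blast
  then have "stability_number (niche_graph D) \<le> enat 3"
    by (rule stability_number_leI)
  then show ?thesis
    by (simp add: numeral_eq_enat)
qed

end
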